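(* Let $n\ge1$, $x,y>0$, $\alpha\in\mathbb R\setminus\{0,\pm1\}$. On the set of $(\Sigma,p)=(\Sigma_1,\dots,\Sigma_n,p_1,\dots,p_n)$ with $\Sigma_i\in\mathbb R\setminus\{0\}$, $p_i\in\mathbb R$, and $\bigl|\log|\Sigma_i|-\log|\Sigma_k|\bigr|>\bigl|\log|\alpha|\bigr|$ for all $i\neq k$, consider the function $$\Phi_1=\tfrac12(x^{-2}+y^2)\sum_{i=1}^n\Sigma_i^{-2}-x^{-1}\sum_{i=1}^n(\cos p_i)\sqrt{1+\Sigma_i^{-2}}\sqrt{x^2+y^2\Sigma_i^{-2}}\prod_{k\ne i}\left[\frac{(\alpha^{-1}\Sigma_k^2-\alpha\Sigma_i^2)(\alpha\Sigma_k^2-\alpha^{-1}\Sigma_i^2)}{(\Sigma_k^2-\Sigma_i^2)^2}\right]^{1/2}$$ and the symplectic form $2\sum_{i=1}^n dp_i\wedge\Sigma_i^{-1}d\Sigma_i$. The transformations $$(\Sigma_i,p_i)\mapsto(-\Sigma_i,p_i)\quad (i=1,\dots,n;\ \text{other coordinates fixed}),$$ $$(\Sigma_i,\Sigma_k,p_i,p_k)\mapsto(\Sigma_k,\Sigma_i,p_k,p_i)\quad (i,k=1,\dots,n;\ \text{other coordinates fixed})$$ generate an action of the Weyl group of the $BC_n$ root system which preserves the symplectic form and leaves $\Phi_1$ invariant.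
   Context: The Weyl group of type $BC_n$ is the group of signed permutations of $n$ coordinates, $(\mathbb Z/2)^n\rtimes S_n$. All square roots are nonnegative; their arguments are positive on the indicated domain. In the paper $\Sigma_i=\sinh\Delta_i$ and the transformations are the symplectic lifts of $\Delta_i\mapsto-\Delta_i$ and $(\Delta_i,\Delta_k)\mapsto(\Delta_k,\Delta_i)$. *)

theory Defs
  imports
    "HOL-Analysis.Analysis"
    "HOL-Combinatorics.Transposition"
    "HOL-Algebra.Group_Action"
    "HOL-Algebra.Generated_Groups"
begin

section \<open>The domain and the Hamiltonian\<close>

text \<open>
  The number \<open>n \<ge> 1\<close> of coordinates is \<open>CARD('n)\<close> for a finite index type \<open>'n\<close>.
  A point \<open>(s, p)\<close> of \<open>real ^ 'n \<times> real ^ 'n\<close> has position coordinates \<open>s $ i\<close>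
  (written \<open>Sigma_i\<close> in the comments below) and momentum coordinates \<open>p $ i\<close>.
\<close>

type_synonym 'n phase = "(real ^ 'n) \<times> (real ^ 'n)"

definition phase_domain :: "real \<Rightarrow> ('n::finite) phase set" where
  "phase_domain \<alpha> =
     {(s, p). (\<forall>i. s $ i \<noteq> 0) \<and>
              (\<forall>i k. i \<noteq> k \<longrightarrow> \<bar>ln \<bar>s $ i\<bar> - ln \<bar>s $ k\<bar>\<bar> > \<bar>ln \<bar>\<alpha>\<bar>\<bar>)}"

definition Phi1 :: "real \<Rightarrow> real \<Rightarrow> real \<Rightarrow> ('n::finite) phase \<Rightarrow> real" where
  "Phi1 x y \<alpha> = (\<lambda>(s, p).
     1/2 * (1 / x\<^sup>2 + y\<^sup>2) * (\<Sum>i\<in>UNIV. 1 / (s $ i)\<^sup>2)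
     - 1 / x * (\<Sum>i\<in>UNIV. cos (p $ i) * sqrt (1 + 1 / (s $ i)\<^sup>2) * sqrt (x\<^sup>2 + y\<^sup>2 / (s $ i)\<^sup>2)
         * (\<Prod>k\<in>UNIV - {i}.
              sqrt ((1 / \<alpha> * (s $ k)\<^sup>2 - \<alpha> * (s $ i)\<^sup>2) * (\<alpha> * (s $ k)\<^sup>2 - 1 / \<alpha> * (s $ i)\<^sup>2)
                    / ((s $ k)\<^sup>2 - (s $ i)\<^sup>2)\<^sup>2))))"


section \<open>The symplectic form and its preservation\<close>

definition wedge :: "('v \<Rightarrow> real) \<Rightarrow> ('v \<Rightarrow> real) \<Rightarrow> 'v \<Rightarrow> 'v \<Rightarrow> real" where
  "wedge a b u v = a u * b v - a v * b u"

text \<open>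
  A 2-form assigns to each point \<open>z\<close> an alternating bilinear form on tangent vectors.
  The coordinate 1-forms \<open>dSigma_i\<close> and \<open>dp_i\<close> are the coordinate functions on
  tangent vectors.
\<close>

definition dSig :: "'n \<Rightarrow> ('n::finite) phase \<Rightarrow> real" where
  "dSig i v = fst v $ i"

definition dp :: "'n \<Rightarrow> ('n::finite) phase \<Rightarrow> real" where
  "dp i v = snd v $ i"

definition symp_form :: "('n::finite) phase \<Rightarrow> 'n phase \<Rightarrow> 'n phase \<Rightarrow> real" where
  "symp_form z u v = 2 * (\<Sum>i\<in>UNIV. wedge (dp i) (\<lambda>w. dSig i w / (fst z $ i)) u v)"

text \<open>
  Meant for open \<open>D\<close>, so that derivatives at points of \<open>D\<close> depend only on
  the values of \<open>T\<close> on \<open>D\<close>.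
\<close>

definition preserves_form ::
    "'v::real_normed_vector set \<Rightarrow> ('v \<Rightarrow> 'v \<Rightarrow> 'v \<Rightarrow> real) \<Rightarrow> ('v \<Rightarrow> 'v) \<Rightarrow> bool" where
  "preserves_form D \<omega> T \<longleftrightarrow>
     (\<forall>z\<in>D. T differentiable (at z) \<and>
        (\<forall>u v. \<omega> (T z) (frechet_derivative T (at z) u) (frechet_derivative T (at z) v) = \<omega> z u v))"


section \<open>The transformations\<close>

definition sign_flip :: "'n \<Rightarrow> ('n::finite) phase \<Rightarrow> 'n phase" where
  "sign_flip i = (\<lambda>(s, p). (\<chi> j. if j = i then - s $ j else s $ j, p))"

definition coord_swap :: "'n \<Rightarrow> 'n \<Rightarrow> ('n::finite) phase \<Rightarrow> 'n phase" where
  "coord_swap i k = (\<lambda>(s, p).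
     (\<chi> j. s $ (Transposition.transpose i k j), \<chi> j. p $ (Transposition.transpose i k j)))"


section \<open>The Weyl group of type BC\<close>

text \<open>
  The semidirect product of sign vectors and permutations; the pair \<open>(e, f)\<close> stands for
  the signed permutation \<open>(v_i) \<mapsto> (e_i * v_(f^-1 i))\<close>, and the product is composition of
  signed permutations.
\<close>

definition weyl_BC :: "(('n::finite \<Rightarrow> int) \<times> ('n \<Rightarrow> 'n)) monoid" where
  "weyl_BC =
     \<lparr>carrier = {(e, f). range e \<subseteq> {1, -1} \<and> bij f},
      mult = (\<lambda>(e, f) (e', f'). (\<lambda>i. e i * e' (inv_into UNIV f i), f \<circ> f')),
      one = (\<lambda>i. 1, id)\<rparr>"

definition weyl_sign :: "'n::finite \<Rightarrow> ('n \<Rightarrow> int) \<times> ('n \<Rightarrow> 'n)" where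
  "weyl_sign i = (\<lambda>j. if j = i then -1 else 1, id)"

definition weyl_transp :: "'n::finite \<Rightarrow> 'n \<Rightarrow> ('n \<Rightarrow> int) \<times> ('n \<Rightarrow> 'n)" where
  "weyl_transp i k = (\<lambda>j. 1, Transposition.transpose i k)"

end

theory Submission
  imports Defs "HOL-Combinatorics.Permutations"
begin

text \<open>A signed permutation acts on phase space by its signed permutation matrix on the
  positions and by the underlying permutation alone on the momenta. \<open>signed_perm_act\<close>
  gives this by one formula for the whole group, so the action law is a computation instead of a
  check of Coxeter relations, and each property is proved for all group elements at once.

  The domain sees only the \<bar>Sigma_i\<bar>, and \<open>Phi1\<close> sees the positions only
  through Sigma_i^2; both are symmetric in the indices (\<open>signed_perm_act_in_domain\<close>,
  \<open>Phi1_signed_perm_act\<close>). The map is linear, hence its own derivative, and the sign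
  cancels in dSigma_i / Sigma_i, so the form is merely reindexed
  (\<open>symp_form_signed_perm_act\<close>). A point with well separated positive positions shows
  faithfulness (\<open>inj_on_weyl_action\<close>). Finally, sign changes and transpositions
  generate the group (\<open>generate_weyl_BC\<close>), and homomorphisms respect
  generation.\<close>

section \<open>The group of signed permutations\<close>

lemma sign_cases:
  fixes e :: "'n \<Rightarrow> int"
  assumes "range e \<subseteq> {1, -1}"
  shows "e j = 1 \<or> e j = -1"
  using assms by (auto simp: image_subset_iff)

lemma in_weyl_BC_iff [simp]:
  "(e, f) \<in> carrier weyl_BC \<longleftrightarrow> range e \<subseteq> {1, -1} \<and> bij f"
  by (simp add: weyl_BC_def)

lemma weyl_BC_mult [simp]:
  "(e, f) \<otimes>\<^bsub>weyl_BC\<^esub> (e', f') = (\<lambda>i. e i * e' (inv_into UNIV f i), f \<circ> f')"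
  by (simp add: weyl_BC_def)

lemma weyl_BC_one: "\<one>\<^bsub>weyl_BC\<^esub> = (\<lambda>i. 1, id)"
  by (simp add: weyl_BC_def)

lemma weyl_BC_mult_closed:
  fixes e e' :: "'n::finite \<Rightarrow> int"
  assumes "(e, f) \<in> carrier weyl_BC" and "(e', f') \<in> carrier weyl_BC"
  shows "(e, f) \<otimes>\<^bsub>weyl_BC\<^esub> (e', f') \<in> carrier weyl_BC"
proof -
  have "e i * e' j = 1 \<or> e i * e' j = -1" for i j
    using sign_cases[of e i] sign_cases[of e' j] assms by auto
  then show ?thesis
    using assms by (auto simp: bij_comp)
qed

lemma group_weyl_BC: "group (weyl_BC :: (('n::finite \<Rightarrow> int) \<times> ('n \<Rightarrow> 'n)) monoid)"
proof (rule groupI)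
  fix a b :: "('n \<Rightarrow> int) \<times> ('n \<Rightarrow> 'n)"
  assume "a \<in> carrier weyl_BC" "b \<in> carrier weyl_BC"
  then show "a \<otimes>\<^bsub>weyl_BC\<^esub> b \<in> carrier weyl_BC"
    by (cases a, cases b) (simp only: weyl_BC_mult_closed)
next
  show "\<one>\<^bsub>weyl_BC\<^esub> \<in> carrier (weyl_BC :: (('n \<Rightarrow> int) \<times> ('n \<Rightarrow> 'n)) monoid)"
    by (auto simp: weyl_BC_one)
next
  fix a b c :: "('n \<Rightarrow> int) \<times> ('n \<Rightarrow> 'n)"
  assume "a \<in> carrier weyl_BC" "b \<in> carrier weyl_BC" "c \<in> carrier weyl_BC"
  then show "a \<otimes>\<^bsub>weyl_BC\<^esub> b \<otimes>\<^bsub>weyl_BC\<^esub> c = a \<otimes>\<^bsub>weyl_BC\<^esub> (b \<otimes>\<^bsub>weyl_BC\<^esub> c)"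
    by (cases a, cases b, cases c) (auto simp: o_inv_distrib mult.assoc)
next
  fix a :: "('n \<Rightarrow> int) \<times> ('n \<Rightarrow> 'n)"
  assume "a \<in> carrier weyl_BC"
  then show "\<one>\<^bsub>weyl_BC\<^esub> \<otimes>\<^bsub>weyl_BC\<^esub> a = a"
    by (cases a) (simp add: weyl_BC_one)
next
  fix a :: "('n \<Rightarrow> int) \<times> ('n \<Rightarrow> 'n)"
  assume a: "a \<in> carrier weyl_BC"
  obtain e f where ef: "a = (e, f)" by (cases a)
  have f: "bij f" and e: "range e \<subseteq> {1, -1}" using a ef by auto
  have sq: "e j * e j = 1" for j using sign_cases[OF e, of j] by auto
  \<comment> \<open>Moving entries back along f moves the signs too: position j of the inverse must
    undo the sign at f j, and each sign is its own inverse.\<close>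
  have "(e \<circ> f, inv_into UNIV f) \<in> carrier weyl_BC"
    using e f by (auto simp: bij_imp_bij_inv)
  moreover have "(e \<circ> f, inv_into UNIV f) \<otimes>\<^bsub>weyl_BC\<^esub> a = \<one>\<^bsub>weyl_BC\<^esub>"
    using f by (simp add: ef weyl_BC_one inv_inv_eq sq bij_is_inj)
  ultimately show "\<exists>b\<in>carrier weyl_BC. b \<otimes>\<^bsub>weyl_BC\<^esub> a = \<one>\<^bsub>weyl_BC\<^esub>" by blast
qed

section \<open>Generation by sign changes and transpositions\<close>

abbreviation weyl_generators :: "(('n::finite \<Rightarrow> int) \<times> ('n \<Rightarrow> 'n)) set" where
  "weyl_generators \<equiv> range weyl_sign \<union> {weyl_transp i k | i k. True}"

lemma weyl_generators_subset: "weyl_generators \<subseteq> carrier weyl_BC"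
  by (auto simp: weyl_sign_def weyl_transp_def)

lemma perm_in_generate:
  fixes f :: "'n::finite \<Rightarrow> 'n"
  assumes "bij f"
  shows "(\<lambda>_. 1, f) \<in> generate weyl_BC weyl_generators"
proof -
  have "f permutes UNIV" "finite (UNIV :: 'n set)" using assms by (auto intro: bij_imp_permutes)
  then show ?thesis
  proof (induction rule: permutes_induct)
    case id
    then show ?case using generate.one[of weyl_BC weyl_generators] by (simp add: weyl_BC_one id_def)
  next
    case (swap a b p)
    have "weyl_transp a b \<in> generate weyl_BC weyl_generators"
      by (intro generate.incl) blast
    from generate.eng[OF this swap.IH] show ?case by (simp add: weyl_transp_def comp_def)
  qed
qed

lemma signs_in_generate:
  fixes A :: "'n::finite set"
  shows "(\<lambda>j. if j \<in> A then -1 else 1, id) \<in> generate weyl_BC weyl_generators"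
  using finite[of A]
proof (induction A rule: finite_induct)
  case empty
  then show ?case using generate.one[of weyl_BC weyl_generators] by (simp add: weyl_BC_one id_def)
next
  case (insert i A)
  have "weyl_sign i \<in> generate weyl_BC weyl_generators"
    by (intro generate.incl) blast
  from generate.eng[OF this insert.IH]
  have "(\<lambda>j. (if j = i then -1 else 1) * (if j \<in> A then -1 else 1), id)
      \<in> generate weyl_BC weyl_generators"
    by (simp add: weyl_sign_def id_def comp_def)
  \<comment> \<open>As i lies outside A, no entry receives both factors -1.\<close>
  also have "(\<lambda>j. (if j = i then -1 else 1) * (if j \<in> A then -1 else 1 :: int))
      = (\<lambda>j. if j \<in> insert i A then -1 else 1)"
    using insert.hyps by auto
  finally show ?case .
qed

text \<open>The semidirect factorization (e, f) = (e, id) (1, f) splits an element into a product of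
  sign changes and a product of transpositions.\<close>

lemma generate_weyl_BC: "generate weyl_BC weyl_generators = carrier weyl_BC"
proof
  show "generate weyl_BC weyl_generators \<subseteq> carrier weyl_BC"
    using group.generate_incl[OF group_weyl_BC weyl_generators_subset] .
  show "carrier weyl_BC \<subseteq> generate weyl_BC weyl_generators"
  proof
    fix w :: "('n::finite \<Rightarrow> int) \<times> ('n \<Rightarrow> 'n)"
    assume w: "w \<in> carrier weyl_BC"
    obtain e f where ef: "w = (e, f)" by (cases w)
    have e: "e = (\<lambda>j. if j \<in> {j. e j = -1} then -1 else 1)"
      using sign_cases[of e] w ef by fastforce
    have "(\<lambda>j. if j \<in> {j. e j = -1} then -1 else 1, id) \<otimes>\<^bsub>weyl_BC\<^esub> (\<lambda>_. 1, f)
        \<in> generate weyl_BC weyl_generators"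
      using w ef by (intro generate.eng signs_in_generate perm_in_generate) auto
    then show "w \<in> generate weyl_BC weyl_generators"
      unfolding e[symmetric] by (simp add: ef)
  qed
qed

section \<open>The action on phase space\<close>

text \<open>Reading coordinates at the inverse of f, as the product of \<open>weyl_BC\<close> does,
  makes this a left action.\<close>

definition signed_perm_act ::
    "('n::finite \<Rightarrow> int) \<times> ('n \<Rightarrow> 'n) \<Rightarrow> 'n phase \<Rightarrow> 'n phase" where
  "signed_perm_act = (\<lambda>(e, f) (s, p).
     (\<chi> j. of_int (e j) * s $ inv_into UNIV f j, \<chi> j. p $ inv_into UNIV f j))"

lemma signed_perm_act_one: "signed_perm_act \<one>\<^bsub>weyl_BC\<^esub> z = z"
  by (cases z) (simp add: signed_perm_act_def weyl_BC_one vec_eq_iff)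

lemma signed_perm_act_mult:
  assumes "v \<in> carrier weyl_BC" and "w \<in> carrier weyl_BC"
  shows "signed_perm_act (v \<otimes>\<^bsub>weyl_BC\<^esub> w) z = signed_perm_act v (signed_perm_act w z)"
  using assms
  by (cases v, cases w, cases z)
    (auto simp: signed_perm_act_def vec_eq_iff o_inv_distrib mult.assoc)

lemma signed_perm_act_sign: "signed_perm_act (weyl_sign i) = sign_flip i"
  by (auto simp: fun_eq_iff signed_perm_act_def weyl_sign_def sign_flip_def vec_eq_iff)

lemma signed_perm_act_transp: "signed_perm_act (weyl_transp i k) = coord_swap i k"
  by (auto simp: fun_eq_iff signed_perm_act_def weyl_transp_def coord_swap_def vec_eq_iff)

lemma abs_sign [simp]:
  fixes e :: "'n \<Rightarrow> int"
  assumes "range e \<subseteq> {1, -1}"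
  shows "\<bar>real_of_int (e j)\<bar> = 1"
  using sign_cases[OF assms, of j] by auto

text \<open>Signs disappear in absolute values, and a permutation sends distinct indices to distinct
  indices.\<close>

lemma signed_perm_act_in_domain:
  assumes w: "w \<in> carrier weyl_BC" and z: "z \<in> phase_domain \<alpha>"
  shows "signed_perm_act w z \<in> phase_domain \<alpha>"
proof -
  obtain e f s p where ef: "w = (e, f)" "z = (s, p)" by (cases w, cases z)
  have f: "bij f" and e: "range e \<subseteq> {1, -1}" using w ef by auto
  have "e j \<noteq> 0" for j using sign_cases[OF e, of j] by auto
  moreover have "inv_into UNIV f i \<noteq> inv_into UNIV f k" if "i \<noteq> k" for i k
    using that bij_imp_bij_inv[OF f] by (metis bij_pointE)
  ultimately show ?thesis
    using z e by (auto simp: ef signed_perm_act_def phase_domain_def abs_mult)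
qed

text \<open>Elements of \<open>Bij\<close> must be extensional, so the map is made
  \<open>undefined\<close> off the domain.\<close>

definition weyl_action ::
    "real \<Rightarrow> ('n::finite \<Rightarrow> int) \<times> ('n \<Rightarrow> 'n) \<Rightarrow> 'n phase \<Rightarrow> 'n phase" where
  "weyl_action \<alpha> w = restrict (signed_perm_act w) (phase_domain \<alpha>)"

lemma weyl_action_Bij:
  fixes w :: "('n::finite \<Rightarrow> int) \<times> ('n \<Rightarrow> 'n)"
  assumes w: "w \<in> carrier weyl_BC"
  shows "weyl_action \<alpha> w \<in> Bij (phase_domain \<alpha>)"
proof -
  let ?v = "inv\<^bsub>weyl_BC\<^esub> w"
  have v: "?v \<in> carrier weyl_BC" using group.inv_closed[OF group_weyl_BC w] .
  have "signed_perm_act ?v (signed_perm_act w z) = z"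
    and "signed_perm_act w (signed_perm_act ?v z) = z" for z
    using signed_perm_act_mult[OF v w, of z] signed_perm_act_mult[OF w v, of z]
    by (simp_all add: group.l_inv[OF group_weyl_BC w] group.r_inv[OF group_weyl_BC w]
        signed_perm_act_one)
  then have "bij_betw (signed_perm_act w) (phase_domain \<alpha>) (phase_domain \<alpha>)"
    by (intro bij_betw_byWitness[where f' = "signed_perm_act ?v"])
      (use signed_perm_act_in_domain w v in blast)+
  then show ?thesis
    by (auto simp: Bij_def weyl_action_def cong: bij_betw_cong)
qed

lemma group_hom_weyl_action:
  "group_hom weyl_BC (BijGroup (phase_domain \<alpha>)) (weyl_action \<alpha>)"
proof (intro group_hom.intro group_hom_axioms.intro group_weyl_BC group_BijGroup homI)
  fix v w :: "('n::finite \<Rightarrow> int) \<times> ('n \<Rightarrow> 'n)"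
  assume v: "v \<in> carrier weyl_BC" and w: "w \<in> carrier weyl_BC"
  show "weyl_action \<alpha> v \<in> carrier (BijGroup (phase_domain \<alpha>))"
    using weyl_action_Bij[OF v] by (simp add: BijGroup_def)
  show "weyl_action \<alpha> (v \<otimes>\<^bsub>weyl_BC\<^esub> w) =
      weyl_action \<alpha> v \<otimes>\<^bsub>BijGroup (phase_domain \<alpha>)\<^esub> weyl_action \<alpha> w"
    using weyl_action_Bij[OF v] weyl_action_Bij[OF w]
    by (auto simp: BijGroup_def compose_def weyl_action_def fun_eq_iff restrict_def
        signed_perm_act_mult[OF v w] signed_perm_act_in_domain[OF w])
qed

section \<open>Faithfulness\<close>

text \<open>
  A point with positive positions has trivial stabilizer: the distinct absolute values recover
  the permutation, and then the signs.
\<close>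

lemma inj_on_weyl_action: "inj_on (weyl_action \<alpha>) (carrier weyl_BC)"
proof (rule inj_onI)
  fix v w :: "('n::finite \<Rightarrow> int) \<times> ('n \<Rightarrow> 'n)"
  assume v: "v \<in> carrier weyl_BC" and w: "w \<in> carrier weyl_BC"
    and eq: "weyl_action \<alpha> v = weyl_action \<alpha> w"
  obtain e f e' f' where ef: "v = (e, f)" "w = (e', f')" by (cases v, cases w)
  have f: "bij f" "bij f'" and e: "range e \<subseteq> {1, -1}" "range e' \<subseteq> {1, -1}"
    using v w ef by auto
  obtain h :: "'n \<Rightarrow> nat" where h: "inj h"
    using finite_imp_inj_to_nat_seg[OF finite[of "UNIV :: 'n set"]] by auto
  \<comment> \<open>The logarithms are distinct integer multiples of a step exceeding \<bar>ln
    \<bar>\<alpha>\<bar>\<bar>, which is the separation that the domain demands.\<close>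
  define s :: "real ^ 'n" where "s = (\<chi> i. exp ((\<bar>ln \<bar>\<alpha>\<bar>\<bar> + 1) * real (h i)))"
  have "\<bar>ln \<bar>\<alpha>\<bar>\<bar> < \<bar>(\<bar>ln \<bar>\<alpha>\<bar>\<bar> + 1) * real (h i) - (\<bar>ln \<bar>\<alpha>\<bar>\<bar> + 1) * real (h k)\<bar>"
    if "i \<noteq> k" for i k
  proof -
    have "h i \<noteq> h k" using h that by (auto dest: injD)
    then have "1 \<le> \<bar>real (h i) - real (h k)\<bar>" by linarith
    then have "(\<bar>ln \<bar>\<alpha>\<bar>\<bar> + 1) * 1 \<le> (\<bar>ln \<bar>\<alpha>\<bar>\<bar> + 1) * \<bar>real (h i) - real (h k)\<bar>"
      by (intro mult_left_mono) auto
    also have "\<dots> = \<bar>(\<bar>ln \<bar>\<alpha>\<bar>\<bar> + 1) * real (h i) - (\<bar>ln \<bar>\<alpha>\<bar>\<bar> + 1) * real (h k)\<bar>"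
      by (simp add: abs_mult flip: right_diff_distrib)
    finally show ?thesis by simp
  qed
  then have "(s, 0) \<in> phase_domain \<alpha>"
    by (simp add: phase_domain_def s_def)
  then have "signed_perm_act v (s, 0) = signed_perm_act w (s, 0)"
    using fun_cong[OF eq, of "(s, 0)"] by (simp add: weyl_action_def)
  then have act: "real_of_int (e j) * s $ inv_into UNIV f j =
      real_of_int (e' j) * s $ inv_into UNIV f' j" for j
    by (simp add: signed_perm_act_def ef vec_eq_iff)
  have pos: "s $ j > 0" for j by (simp add: s_def)
  \<comment> \<open>Absolute values strip the signs; injectivity of exp and of h then recovers the
    permutation.\<close>
  have s_eq: "s $ inv_into UNIV f j = s $ inv_into UNIV f' j" for j
    using arg_cong[OF act[of j], of abs] pos by (simp add: abs_mult e less_imp_le)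
  then have "h (inv_into UNIV f j) = h (inv_into UNIV f' j)" for j
    by (simp add: s_def add_nonneg_eq_0_iff)
  then have "inv_into UNIV f = inv_into UNIV f'"
    using h by (auto simp: fun_eq_iff dest: injD)
  then have "f = f'" using f by (metis inv_inv_eq)
  moreover have "e j = e' j" for j
    using act[of j] s_eq[of j] pos[of "inv_into UNIV f' j"] by simp
  ultimately show "v = w" by (auto simp: ef)
qed

section \<open>Preservation of the symplectic form\<close>

text \<open>The domain is cut out by finitely many strict conditions on functions continuous where
  all positions are nonzero. Openness lets the restricted action inherit the derivative of the
  unrestricted linear map.\<close>

lemma open_phase_domain: "open (phase_domain \<alpha> :: ('n::finite) phase set)"
proof (rule Topological_Spaces.openI)
  fix z :: "'n phase"
  assume z: "z \<in> phase_domain \<alpha>"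
  have nz: "fst z $ i \<noteq> 0" for i
    using z by (auto simp: phase_domain_def)
  have lim: "((\<lambda>z. fst z $ i) \<longlongrightarrow> fst z $ i) (nhds z)" for i
    by (intro tendsto_intros filterlim_ident)
  have "\<forall>\<^sub>F z in nhds z. fst z $ i \<noteq> 0" for i
    using lim nz by (rule tendsto_imp_eventually_ne)
  moreover have "\<forall>\<^sub>F z in nhds z. i \<noteq> k \<longrightarrow> \<bar>ln \<bar>\<alpha>\<bar>\<bar> < \<bar>ln \<bar>fst z $ i\<bar> - ln \<bar>fst z $ k\<bar>\<bar>" for i k
  proof (cases "i = k")
    case False
    have "((\<lambda>z. \<bar>ln \<bar>fst z $ i\<bar> - ln \<bar>fst z $ k\<bar>\<bar>) \<longlongrightarrow> \<bar>ln \<bar>fst z $ i\<bar> - ln \<bar>fst z $ k\<bar>\<bar>) (nhds z)"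
      using nz by (intro tendsto_intros lim) auto
    moreover have "\<bar>ln \<bar>\<alpha>\<bar>\<bar> < \<bar>ln \<bar>fst z $ i\<bar> - ln \<bar>fst z $ k\<bar>\<bar>"
      using z False by (auto simp: phase_domain_def)
    ultimately show ?thesis by (auto dest: order_tendstoD(1) elim: eventually_mono)
  qed simp
  ultimately have "\<forall>\<^sub>F z in nhds z. z \<in> phase_domain \<alpha>"
    by (simp add: phase_domain_def case_prod_beta eventually_conj_iff eventually_all_finite)
  then show "\<exists>T. open T \<and> z \<in> T \<and> T \<subseteq> phase_domain \<alpha>"
    by (auto simp: eventually_nhds)
qed

lemma linear_signed_perm_act: "linear (signed_perm_act w)"
  by (intro linearI)
    (simp_all add: signed_perm_act_def case_prod_beta prod_eq_iff vec_eq_iff algebra_simps)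

lemma weyl_action_has_derivative:
  assumes "z \<in> phase_domain \<alpha>"
  shows "(weyl_action \<alpha> w has_derivative signed_perm_act w) (at z)"
proof (rule has_derivative_transform_within_open[OF _ open_phase_domain assms])
  show "(signed_perm_act w has_derivative signed_perm_act w) (at z)"
    using linear_signed_perm_act[of w]
    by (intro bounded_linear_imp_has_derivative) (simp add: linear_conv_bounded_linear)
qed (simp add: weyl_action_def)

text \<open>The sign e_i multiplies both dSigma_i and Sigma_i, so it cancels in their quotient; what
  is left is the same sum in permuted order.\<close>

lemma symp_form_signed_perm_act:
  assumes w: "w \<in> carrier weyl_BC"
  shows "symp_form (signed_perm_act w z) (signed_perm_act w u) (signed_perm_act w v)
    = symp_form z u v"
proof -
  obtain e f where ef: "w = (e, f)" by (cases w)
  have f: "bij f" and e: "range e \<subseteq> {1, -1}" using w ef by auto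
  have nz: "e j \<noteq> 0" for j using sign_cases[OF e, of j] by auto
  let ?F = "\<lambda>i. wedge (dp i) (\<lambda>w. dSig i w / (fst z $ i)) u v"
  have "symp_form (signed_perm_act w z) (signed_perm_act w u) (signed_perm_act w v)
      = 2 * (\<Sum>i\<in>UNIV. ?F (inv_into UNIV f i))"
    by (simp add: symp_form_def wedge_def dp_def dSig_def signed_perm_act_def ef nz
        split: prod.splits)
  also have "(\<Sum>i\<in>UNIV. ?F (inv_into UNIV f i)) = (\<Sum>i\<in>UNIV. ?F i)"
    by (rule sum.reindex_bij_betw[OF bij_imp_bij_inv[OF f]])
  finally show ?thesis by (simp add: symp_form_def)
qed

lemma preserves_form_weyl_action:
  assumes "w \<in> carrier weyl_BC"
  shows "preserves_form (phase_domain \<alpha>) symp_form (weyl_action \<alpha> w)"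
  unfolding preserves_form_def
proof (intro ballI conjI allI)
  fix z :: "'a phase" and u v
  assume z: "z \<in> phase_domain \<alpha>"
  note D = weyl_action_has_derivative[OF z, of w]
  show "weyl_action \<alpha> w differentiable at z"
    using D by (rule differentiableI)
  show "symp_form (weyl_action \<alpha> w z) (frechet_derivative (weyl_action \<alpha> w) (at z) u)
      (frechet_derivative (weyl_action \<alpha> w) (at z) v) = symp_form z u v"
    \<comment> \<open>Uniqueness of the derivative replaces the chosen
      \<open>frechet_derivative\<close> by \<open>signed_perm_act w\<close>.\<close>
    unfolding frechet_derivative_at[OF D, symmetric]
    using symp_form_signed_perm_act[OF assms] z by (simp add: weyl_action_def)
qed

section \<open>Invariance of the Hamiltonian\<close>

lemma Phi1_signed_perm_act:
  fixes w :: "('n::finite \<Rightarrow> int) \<times> ('n \<Rightarrow> 'n)"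
  assumes w: "w \<in> carrier weyl_BC"
  shows "Phi1 x y \<alpha> (signed_perm_act w z) = Phi1 x y \<alpha> z"
proof -
  obtain e f s p where ef: "w = (e, f)" "z = (s, p)" by (cases w, cases z)
  define g where "g = inv_into UNIV f"
  have g: "bij g" and e: "range e \<subseteq> {1, -1}"
    using w ef by (auto simp: g_def bij_imp_bij_inv)
  have sq: "(real_of_int (e j))\<^sup>2 = 1" for j using sign_cases[OF e, of j] by auto
  define P where "P = (\<lambda>i k. sqrt ((1 / \<alpha> * (s $ k)\<^sup>2 - \<alpha> * (s $ i)\<^sup>2)
      * (\<alpha> * (s $ k)\<^sup>2 - 1 / \<alpha> * (s $ i)\<^sup>2) / ((s $ k)\<^sup>2 - (s $ i)\<^sup>2)\<^sup>2))"
  define C where "C = (\<lambda>i. cos (p $ i) * sqrt (1 + 1 / (s $ i)\<^sup>2) * sqrt (x\<^sup>2 + y\<^sup>2 / (s $ i)\<^sup>2))"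
  \<comment> \<open>The inner products omit the index i, so they must be reindexed onto the
    complement of g i before the outer sum can be reindexed.\<close>
  have "bij_betw g (UNIV - {i}) (UNIV - {g i})" for i
    using g by (simp add: bij_betw_DiffI bij_betw_singletonI)
  then have prod: "(\<Prod>k\<in>UNIV - {i}. P (g i) (g k)) = (\<Prod>k\<in>UNIV - {g i}. P (g i) k)" for i
    by (rule prod.reindex_bij_betw)
  have "Phi1 x y \<alpha> (signed_perm_act w z)
      = 1/2 * (1 / x\<^sup>2 + y\<^sup>2) * (\<Sum>i\<in>UNIV. 1 / (s $ g i)\<^sup>2)
        - 1 / x * (\<Sum>i\<in>UNIV. C (g i) * (\<Prod>k\<in>UNIV - {i}. P (g i) (g k)))"
    by (simp add: Phi1_def signed_perm_act_def ef P_def C_def power_mult_distrib sq g_def)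
  also have "(\<Sum>i\<in>UNIV. C (g i) * (\<Prod>k\<in>UNIV - {i}. P (g i) (g k)))
      = (\<Sum>i\<in>UNIV. C i * (\<Prod>k\<in>UNIV - {i}. P i k))"
    unfolding prod by (rule sum.reindex_bij_betw[OF g])
  also have "(\<Sum>i\<in>UNIV. 1 / (s $ g i)\<^sup>2) = (\<Sum>i\<in>UNIV. 1 / (s $ i)\<^sup>2)"
    by (rule sum.reindex_bij_betw[OF g])
  finally show ?thesis by (simp add: Phi1_def ef P_def C_def)
qed

theorem mainTheorem3:
  fixes x y \<alpha> :: real
  assumes "x > 0" and "y > 0" and "\<alpha> \<notin> {0, 1, -1}"
  shows "\<exists>\<phi>. faithful_action (weyl_BC :: (('n::finite \<Rightarrow> int) \<times> ('n \<Rightarrow> 'n)) monoid)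
                (phase_domain \<alpha> :: 'n phase set) \<phi>
    \<and> (\<forall>i. \<phi> (weyl_sign i) = restrict (sign_flip i) (phase_domain \<alpha>))
    \<and> (\<forall>i k. \<phi> (weyl_transp i k) = restrict (coord_swap i k) (phase_domain \<alpha>))
    \<and> \<phi> ` carrier weyl_BC =
        generate (BijGroup (phase_domain \<alpha>))
          ({restrict (sign_flip i) (phase_domain \<alpha>) | i. True}
           \<union> {restrict (coord_swap i k) (phase_domain \<alpha>) | i k. True})
    \<and> (\<forall>w\<in>carrier weyl_BC.
          preserves_form (phase_domain \<alpha>) symp_form (\<phi> w)
          \<and> (\<forall>z\<in>phase_domain \<alpha>. Phi1 x y \<alpha> (\<phi> w z) = Phi1 x y \<alpha> z))"
proof (intro exI conjI allI ballI)
  interpret group_hom "weyl_BC :: (('n \<Rightarrow> int) \<times> ('n \<Rightarrow> 'n)) monoid"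
      "BijGroup (phase_domain \<alpha>)" "weyl_action \<alpha>"
    by (rule group_hom_weyl_action)
  show "faithful_action (weyl_BC :: (('n \<Rightarrow> int) \<times> ('n \<Rightarrow> 'n)) monoid)
      (phase_domain \<alpha>) (weyl_action \<alpha>)"
    by (intro faithful_action.intro group_action.intro faithful_action_axioms.intro
        group_hom_weyl_action inj_on_weyl_action)
  show sign: "weyl_action \<alpha> (weyl_sign i) = restrict (sign_flip i) (phase_domain \<alpha>)" for i :: 'n
    by (simp add: weyl_action_def signed_perm_act_sign)
  show transp: "weyl_action \<alpha> (weyl_transp i k) = restrict (coord_swap i k) (phase_domain \<alpha>)"
    for i k :: 'n
    by (simp add: weyl_action_def signed_perm_act_transp)
  \<comment> \<open>A homomorphism carries the subgroup generated by a set to the one generated by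
    its image, so it suffices to identify the images of the generators.\<close>
  have "weyl_action \<alpha> ` {weyl_transp i k | (i :: 'n) k. True} =
      {restrict (coord_swap i k) (phase_domain \<alpha>) | i k. True}"
    unfolding transp[symmetric] by blast
  then have "weyl_action \<alpha> ` weyl_generators =
      {restrict (sign_flip i) (phase_domain \<alpha>) | i :: 'n. True}
      \<union> {restrict (coord_swap i k) (phase_domain \<alpha>) | (i :: 'n) k. True}"
    by (simp add: image_Un image_image sign full_SetCompr_eq)
  then show "weyl_action \<alpha> ` carrier (weyl_BC :: (('n \<Rightarrow> int) \<times> ('n \<Rightarrow> 'n)) monoid) =
      generate (BijGroup (phase_domain \<alpha>))
        ({restrict (sign_flip i) (phase_domain \<alpha>) | i. True}
         \<union> {restrict (coord_swap i k) (phase_domain \<alpha>) | i k. True})"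
    using generate_img[OF weyl_generators_subset] unfolding generate_weyl_BC by simp
next
  fix w :: "('n \<Rightarrow> int) \<times> ('n \<Rightarrow> 'n)"
  assume w: "w \<in> carrier weyl_BC"
  then show "preserves_form (phase_domain \<alpha>) symp_form (weyl_action \<alpha> w)"
    by (rule preserves_form_weyl_action)
  show "Phi1 x y \<alpha> (weyl_action \<alpha> w z) = Phi1 x y \<alpha> z" if "z \<in> phase_domain \<alpha>" for z
    using that Phi1_signed_perm_act[OF w] by (simp add: weyl_action_def)
qed

end
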